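(* Let $u=u(x^1,p^1)$ and $v=v(x^2,p^2)$ be arbitrary smooth functions of the indicated two variables, regarded as functions of $(x^1,x^2,p^1,p^2)$. Then $(u,v)$ solves the system $$\begin{array}{l} u_{p^1p^2}=0,\\ v_{p^1p^2}=0,\\ rs=0,\\ v_{p^1}s_{p^2}+s_{x^1}=0,\\ u_{p^2}r_{p^1}+r_{x^2}=0,\\ s_{p^1}=0,\\ r_{p^2}=0, \end{array}$$ where $$\begin{array}{l} r=v_{x^2p^1}-v_{x^1p^2}+u_{p^2}v_{p^1p^1}+(v_{p^2}-u_{p^1})v_{p^1p^2}-v_{p^1}v_{p^2p^2},\\ s=u_{x^1p^2}-u_{x^2p^1}-u_{p^2}u_{p^1p^1}+(u_{p^1}-v_{p^2})u_{p^1p^2}+v_{p^1}u_{p^2p^2}. \end{array}$$ Moreover, if $u_{p^1p^1p^1}\neq0$ or $v_{p^2p^2p^2}\neq0$, then the cone structure $\mathcal{C}^{(u,v)}$ corresponding to $(u,v)$ is not diffeomorphic to the flat one, i.e. to the cone structure $\mathcal{C}^{(0,0)}$ corresponding to $u=v=0$.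
   Context: Subscripts denote partial derivatives; superscripts on $x,p$ are indices. The cone structure $\mathcal{C}^{(u,v)}$ on the space with coordinates $(x^1,x^2,p^1,p^2)$ is the field of 3-dimensional cones in the tangent spaces given at each point by $\bigcup_\lambda\mathrm{span}\{Y_0(\lambda),Y_1(\lambda)\}$, where $$Y_0=(\cos\lambda)\partial_{p^1}+(\sin\lambda)(\partial_{x^1}+u_{p^1}\partial_{p^1}+v_{p^1}\partial_{p^2}),\qquad Y_1=(\cosh\lambda)\partial_{p^2}+(\sinh\lambda)(\partial_{x^2}+u_{p^2}\partial_{p^1}+v_{p^2}\partial_{p^2}).$$ (Equivalently, the flat structure $\mathcal{C}^{(0,0)}$ is the cone structure on the solution space of the linear ODE system $\ddot x=-x$, $\ddot y=y$.) Two cone structures are diffeomorphic if there is a diffeomorphism of the underlying manifolds whose differential maps the cones of one onto the cones of the other. The conditions $u_{p^1p^1p^1}\ne0$, $v_{p^2p^2p^2}\neq0$ mean that the respective function does not vanish identically. *)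

theory Defs
  imports "HOL-Analysis.Analysis"
begin

text \<open>
  The sets \<open>S\<close>, \<open>M\<close>, \<open>N\<close> below are meant to be open: derivatives are taken with
  respect to full neighbourhoods. In finite dimension, level \<open>n\<close> is the class \<open>C\<^sup>n\<close>.
\<close>

primrec higher_differentiable_on ::
    "'a::real_normed_vector set \<Rightarrow> ('a \<Rightarrow> 'b::real_normed_vector) \<Rightarrow> nat \<Rightarrow> bool" where
  "higher_differentiable_on S f 0 \<longleftrightarrow> continuous_on S f"
| "higher_differentiable_on S f (Suc n) \<longleftrightarrow>
     (\<forall>x\<in>S. f differentiable at x) \<and>
     (\<forall>h. higher_differentiable_on S (\<lambda>x. frechet_derivative f (at x) h) n)"

declare higher_differentiable_on.simps [simp del]

definition smooth_on :: "'a::real_normed_vector set \<Rightarrow> ('a \<Rightarrow> 'b::real_normed_vector) \<Rightarrow> bool" where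
  "smooth_on S f \<longleftrightarrow> (\<forall>n. higher_differentiable_on S f n)"

definition diffeomorphism_on ::
    "'a::real_normed_vector set \<Rightarrow> 'b::real_normed_vector set \<Rightarrow> ('a \<Rightarrow> 'b) \<Rightarrow> bool" where
  "diffeomorphism_on M N \<phi> \<longleftrightarrow>
     bij_betw \<phi> M N \<and> smooth_on M \<phi> \<and> smooth_on N (inv_into M \<phi>)"

text \<open>
  A field of cones on \<open>M\<close> is given by a map that sends each point to a subset of its
  tangent space; the values outside \<open>M\<close> are irrelevant.
\<close>

definition cone_structures_diffeomorphic ::
    "'a::real_normed_vector set \<Rightarrow> ('a \<Rightarrow> 'a set) \<Rightarrow>
     'b::real_normed_vector set \<Rightarrow> ('b \<Rightarrow> 'b set) \<Rightarrow> bool" where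
  "cone_structures_diffeomorphic M C N D \<longleftrightarrow>
     (\<exists>\<phi>. diffeomorphism_on M N \<phi> \<and>
          (\<forall>q\<in>M. frechet_derivative \<phi> (at q) ` C q = D (\<phi> q)))"

text \<open>The coordinates \<open>(x\<^sup>1, x\<^sup>2, p\<^sup>1, p\<^sup>2)\<close> are the components 1, 2, 3, 4.\<close>

abbreviation (input) x1 :: 4 where "x1 \<equiv> 1"
abbreviation (input) x2 :: 4 where "x2 \<equiv> 2"
abbreviation (input) p1 :: 4 where "p1 \<equiv> 3"
abbreviation (input) p2 :: 4 where "p2 \<equiv> 4"

text \<open>
  Iterated subscripts are read from left to right: the subscript \<open>p\<^sup>1p\<^sup>2\<close> on \<open>u\<close>
  becomes \<open>\<partial> p2 (\<partial> p1 u)\<close>.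
\<close>

definition partial_deriv :: "4 \<Rightarrow> (real^4 \<Rightarrow> real) \<Rightarrow> real^4 \<Rightarrow> real" (\<open>\<partial>\<close>) where
  "\<partial> i f q = deriv (\<lambda>t. f (q + t *\<^sub>R axis i 1)) 0"

definition r_expr :: "(real^4 \<Rightarrow> real) \<Rightarrow> (real^4 \<Rightarrow> real) \<Rightarrow> real^4 \<Rightarrow> real" where
  "r_expr u v q =
     \<partial> p1 (\<partial> x2 v) q - \<partial> p2 (\<partial> x1 v) q + \<partial> p2 u q * \<partial> p1 (\<partial> p1 v) q
     + (\<partial> p2 v q - \<partial> p1 u q) * \<partial> p2 (\<partial> p1 v) q - \<partial> p1 v q * \<partial> p2 (\<partial> p2 v) q"

definition s_expr :: "(real^4 \<Rightarrow> real) \<Rightarrow> (real^4 \<Rightarrow> real) \<Rightarrow> real^4 \<Rightarrow> real" where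
  "s_expr u v q =
     \<partial> p2 (\<partial> x1 u) q - \<partial> p1 (\<partial> x2 u) q - \<partial> p2 u q * \<partial> p1 (\<partial> p1 u) q
     + (\<partial> p1 u q - \<partial> p2 v q) * \<partial> p2 (\<partial> p1 u) q + \<partial> p1 v q * \<partial> p2 (\<partial> p2 u) q"

definition solves_system :: "(real^4) set \<Rightarrow> (real^4 \<Rightarrow> real) \<Rightarrow> (real^4 \<Rightarrow> real) \<Rightarrow> bool" where
  "solves_system M u v \<longleftrightarrow> (\<forall>q\<in>M.
     \<partial> p2 (\<partial> p1 u) q = 0 \<and>
     \<partial> p2 (\<partial> p1 v) q = 0 \<and>
     r_expr u v q * s_expr u v q = 0 \<and>
     \<partial> p1 v q * \<partial> p2 (s_expr u v) q + \<partial> x1 (s_expr u v) q = 0 \<and>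
     \<partial> p2 u q * \<partial> p1 (r_expr u v) q + \<partial> x2 (r_expr u v) q = 0 \<and>
     \<partial> p1 (s_expr u v) q = 0 \<and>
     \<partial> p2 (r_expr u v) q = 0)"

definition Y0 :: "(real^4 \<Rightarrow> real) \<Rightarrow> (real^4 \<Rightarrow> real) \<Rightarrow> real \<Rightarrow> real^4 \<Rightarrow> real^4" where
  "Y0 u v l q = cos l *\<^sub>R axis p1 1
     + sin l *\<^sub>R (axis x1 1 + \<partial> p1 u q *\<^sub>R axis p1 1 + \<partial> p1 v q *\<^sub>R axis p2 1)"

definition Y1 :: "(real^4 \<Rightarrow> real) \<Rightarrow> (real^4 \<Rightarrow> real) \<Rightarrow> real \<Rightarrow> real^4 \<Rightarrow> real^4" where
  "Y1 u v l q = cosh l *\<^sub>R axis p2 1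
     + sinh l *\<^sub>R (axis x2 1 + \<partial> p2 u q *\<^sub>R axis p1 1 + \<partial> p2 v q *\<^sub>R axis p2 1)"

definition cone_structure ::
    "(real^4 \<Rightarrow> real) \<Rightarrow> (real^4 \<Rightarrow> real) \<Rightarrow> real^4 \<Rightarrow> (real^4) set" where
  "cone_structure u v q = (\<Union>l. span {Y0 u v l q, Y1 u v l q})"

end

theory Submission
  imports Defs
begin

text \<open>
  The equations hold because every mixed derivative that occurs in them vanishes identically:
  \<open>u\<close> does not depend on \<open>(x\<^sup>2, p\<^sup>2)\<close>, nor \<open>v\<close> on \<open>(x\<^sup>1, p\<^sup>1)\<close>.

  For the second part, write \<open>a = u\<^sub>p\<^sub>1\<close> and \<open>b = v\<^sub>p\<^sub>2\<close>. Each tangent space splits into an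
  oscillator plane with coordinates \<open>(x\<^sup>1, p\<^sup>1)\<close> and a hyperbolic plane with coordinates
  \<open>(x\<^sup>2, p\<^sup>2)\<close>, and the cone consists of the vectors whose two parts have angle and rapidity
  given by a common parameter, measured in the frames \<open>\<partial>\<^sub>p\<^sub>1, \<partial>\<^sub>x\<^sub>1 + a \<partial>\<^sub>p\<^sub>1\<close> and
  \<open>\<partial>\<^sub>p\<^sub>2, \<partial>\<^sub>x\<^sub>2 + b \<partial>\<^sub>p\<^sub>2\<close>. A linear automorphism of the flat cone preserves the splitting, is
  conformal for the Euclidean and the Lorentz form on the two planes, and its rotation angle
  equals its boost parameter (\<open>normal_form\<close>).

  Let a diffeomorphism carry the cones of \<open>(u, v)\<close> to flat ones. Its derivative is block
  diagonal, so it is locally a product of two maps of the plane. The rotation angle of one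
  factor equals the boost parameter of the other, so both are constant
  (\<open>third_derivatives_vanish_if_flat\<close>). In each factor there remains a conformal map to the
  flat plane which turns the frame by a constant amount, and its existence forces the
  coefficient \<open>a\<close>, respectively \<open>b\<close>, to be affine in \<open>p\<^sup>1\<close>, respectively \<open>p\<^sup>2\<close>
  (\<open>affine_coefficient\<close>). Hence \<open>u\<^sub>p\<^sub>1\<^sub>p\<^sub>1\<^sub>p\<^sub>1\<close> and \<open>v\<^sub>p\<^sub>2\<^sub>p\<^sub>2\<^sub>p\<^sub>2\<close> vanish.
\<close>

section \<open>The system of equations\<close>

lemma partial_deriv_cong_zero:
  assumes "\<And>t. f (q + t *\<^sub>R axis i 1) = f q"
  shows "\<partial> i f q = 0"
  unfolding partial_deriv_def using assms by simp

lemma partial_deriv_translate: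
  assumes "\<And>q. f (q + c) = f q"
  shows "\<partial> i f (q + c) = \<partial> i f q"
  unfolding partial_deriv_def using assms[of "q + _ *\<^sub>R axis i 1"] by (simp add: algebra_simps)

lemma separated_solves:
  assumes u: "u = (\<lambda>q. f (q $ x1, q $ p1))" and v: "v = (\<lambda>q. g (q $ x2, q $ p2))"
  shows "solves_system M u v"
proof -
  have u_inv: "u (q + t *\<^sub>R axis x2 1) = u q" "u (q + t *\<^sub>R axis p2 1) = u q" for q t
    by (simp_all add: u axis_def)
  have v_inv: "v (q + t *\<^sub>R axis x1 1) = v q" "v (q + t *\<^sub>R axis p1 1) = v q" for q t
    by (simp_all add: v axis_def)
  have u0: "\<partial> x2 u = (\<lambda>q. 0)" "\<partial> p2 u = (\<lambda>q. 0)" "\<partial> p2 (\<partial> i u) = (\<lambda>q. 0)" for i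
    by (auto intro!: partial_deriv_cong_zero partial_deriv_translate simp: u_inv)
  have v0: "\<partial> x1 v = (\<lambda>q. 0)" "\<partial> p1 v = (\<lambda>q. 0)" "\<partial> p1 (\<partial> i v) = (\<lambda>q. 0)" for i
    by (auto intro!: partial_deriv_cong_zero partial_deriv_translate simp: v_inv)
  have z: "\<partial> i (\<lambda>q. 0) = (\<lambda>q. 0)" for i
    by (auto intro!: partial_deriv_cong_zero)
  have "r_expr u v = (\<lambda>q. 0)" "s_expr u v = (\<lambda>q. 0)"
    by (auto simp: r_expr_def s_expr_def u0 v0 z)
  then show ?thesis
    by (simp add: solves_system_def u0 v0 z)
qed

section \<open>The flat cone and its rulings\<close>

text \<open>
  The plane spanned by the generators of the flat structure at parameter \<open>l\<close>, by equations:
  the component in the \<open>(x\<^sup>1, p\<^sup>1)\<close>-plane is a multiple of \<open>(sin l, cos l)\<close>, the one in the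
  \<open>(x\<^sup>2, p\<^sup>2)\<close>-plane a multiple of \<open>(sinh l, cosh l)\<close>. For the first \<open>l\<close> counts modulo \<open>\<pi>\<close>,
  while the second determines \<open>l\<close>; this asymmetry is what distinguishes the two factors.
\<close>

definition ruling :: "real \<Rightarrow> (real^4) set" where
  "ruling l = {w. w $ x1 * cos l = w $ p1 * sin l \<and> w $ x2 * cosh l = w $ p2 * sinh l}"

definition flat_cone :: "(real^4) set" where
  "flat_cone = (\<Union>l. ruling l)"

text \<open>
  The linear map that takes the generators of the flat structure to those of
  \<open>\<C>\<^sup>(\<^sup>u\<^sup>,\<^sup>v\<^sup>)\<close> at a point with \<open>u\<^sub>p\<^sub>1 = a\<close>, \<open>v\<^sub>p\<^sub>2 = b\<close> and \<open>u\<^sub>p\<^sub>2 = v\<^sub>p\<^sub>1 = 0\<close>.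
\<close>

abbreviation shear :: "real \<Rightarrow> real \<Rightarrow> real^4 \<Rightarrow> real^4" where
  "shear a b w \<equiv> w + (a * w $ x1) *\<^sub>R axis p1 1 + (b * w $ x2) *\<^sub>R axis p2 1"

definition osc_vec :: "real \<Rightarrow> real^4" where
  "osc_vec l = sin l *\<^sub>R axis x1 1 + cos l *\<^sub>R axis p1 1"

definition hyp_vec :: "real \<Rightarrow> real^4" where
  "hyp_vec l = sinh l *\<^sub>R axis x2 1 + cosh l *\<^sub>R axis p2 1"

definition hyp_deriv_vec :: "real \<Rightarrow> real^4" where
  "hyp_deriv_vec l = cosh l *\<^sub>R axis x2 1 + sinh l *\<^sub>R axis p2 1"

lemma tangent_vec_nth:
  "osc_vec l $ x1 = sin l" "osc_vec l $ x2 = 0" "osc_vec l $ p1 = cos l" "osc_vec l $ p2 = 0"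
  "hyp_vec l $ x1 = 0" "hyp_vec l $ x2 = sinh l" "hyp_vec l $ p1 = 0" "hyp_vec l $ p2 = cosh l"
  "hyp_deriv_vec l $ x1 = 0" "hyp_deriv_vec l $ x2 = cosh l" "hyp_deriv_vec l $ p1 = 0"
  "hyp_deriv_vec l $ p2 = sinh l"
  by (simp_all add: osc_vec_def hyp_vec_def hyp_deriv_vec_def axis_def)

lemma cosh_sinh_sq: "cosh (l::real) * cosh l = 1 + sinh l * sinh l"
  using cosh_square_eq[of l] by (simp add: power2_eq_square)

lemma sin_cos_sq: "sin (l::real) * sin l + cos l * cos l = 1"
  using sin_cos_squared_add[of l] by (simp add: power2_eq_square)

lemma ruling_eq_span:
  "ruling l = span {osc_vec l, hyp_vec l}"
proof (intro set_eqI iffI)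
  fix w assume "w \<in> ruling l"
  then have a: "w $ x1 * cos l = w $ p1 * sin l" and b: "w $ x2 * cosh l = w $ p2 * sinh l"
    by (auto simp: ruling_def)
  have "(w $ p1 * cos l + w $ x1 * sin l) * sin l = w $ x1 * (sin l * sin l + cos l * cos l)"
    "(w $ p1 * cos l + w $ x1 * sin l) * cos l = w $ p1 * (sin l * sin l + cos l * cos l)"
    using a by algebra+
  moreover have "(w $ p2 * cosh l - w $ x2 * sinh l) * sinh l = w $ x2 * (cosh l * cosh l - sinh l * sinh l)"
    "(w $ p2 * cosh l - w $ x2 * sinh l) * cosh l = w $ p2 * (cosh l * cosh l - sinh l * sinh l)"
    using b by algebra+
  ultimately have "w = (w $ p1 * cos l + w $ x1 * sin l) *\<^sub>R osc_vec l + (w $ p2 * cosh l - w $ x2 * sinh l) *\<^sub>R hyp_vec l"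
    by (simp add: vec_eq_iff forall_4 axis_def osc_vec_def hyp_vec_def sin_cos_sq cosh_sinh_sq)
  then show "w \<in> span {osc_vec l, hyp_vec l}"
    by (metis insertCI span_add span_base span_scale)
next
  fix w assume "w \<in> span {osc_vec l, hyp_vec l}"
  then obtain s t where "w = s *\<^sub>R osc_vec l + t *\<^sub>R hyp_vec l"
    by (auto simp: span_insert algebra_simps)
  then show "w \<in> ruling l"
    by (simp add: ruling_def axis_def osc_vec_def hyp_vec_def)
qed

lemma subspace_ruling: "subspace (ruling l)"
  by (simp add: ruling_eq_span)

lemma cone_structure_eq_shear:
  assumes "\<partial> p2 u q = 0" "\<partial> p1 v q = 0"
  shows "cone_structure u v q = shear (\<partial> p1 u q) (\<partial> p2 v q) ` flat_cone"
proof -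
  define S where "S = shear (\<partial> p1 u q) (\<partial> p2 v q)"
  have lin: "linear S"
    by (rule linearI) (auto simp: S_def algebra_simps)
  have "span {Y0 u v l q, Y1 u v l q} = S ` ruling l" for l
    unfolding ruling_eq_span linear_span_image[OF lin, symmetric]
    by (rule arg_cong[of _ _ span])
      (simp add: S_def Y0_def Y1_def osc_vec_def hyp_vec_def assms vec_eq_iff forall_4 axis_def algebra_simps)
  then show ?thesis
    by (simp add: cone_structure_def flat_cone_def image_UN S_def)
qed

lemma flat_cone_iff:
  "w \<in> flat_cone \<longleftrightarrow> (\<exists>l. w $ x1 * cos l = w $ p1 * sin l \<and> w $ x2 * cosh l = w $ p2 * sinh l)"
  by (auto simp: flat_cone_def ruling_def)

lemma ruling_subset: "w \<in> ruling l \<Longrightarrow> w \<in> flat_cone"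
  by (auto simp: flat_cone_def)

lemma flat_cone_timelike:
  assumes "w \<in> flat_cone" "w $ p2 \<noteq> 0"
  shows "(w $ x2)\<^sup>2 < (w $ p2)\<^sup>2"
proof -
  obtain l where l: "w $ x2 * cosh l = w $ p2 * sinh l"
    using assms(1) by (auto simp: flat_cone_iff)
  then have "w $ x2 = w $ p2 * tanh l" by (simp add: tanh_def field_simps)
  moreover have "(tanh l)\<^sup>2 < 1"
    using tanh_real_bounds[of l] by (simp add: abs_square_less_1 abs_if)
  ultimately show ?thesis
    using assms(2) by (simp add: power_mult_distrib)
qed

lemma flat_cone_p2_zero: "w \<in> flat_cone \<Longrightarrow> w $ p2 = 0 \<Longrightarrow> w $ x2 = 0"
  by (auto simp: flat_cone_iff)

lemma ex_tanh:
  assumes "(x::real) \<in> {-1<..<1}" shows "\<exists>l. tanh l = x"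
proof -
  define l where "l = ln ((1 + x) / (1 - x)) / 2"
  have E: "exp (- 2 * l) = (1 - x) / (1 + x)"
    using assms by (simp add: l_def exp_minus)
  have "tanh l = x"
    unfolding tanh_real_altdef E using assms by (simp add: divide_simps)
  then show ?thesis by blast
qed

lemma timelike_in_flat_cone:
  assumes "w $ x1 = 0" "w $ p1 = 0" "\<bar>w $ x2\<bar> < \<bar>w $ p2\<bar>"
  shows "w \<in> flat_cone"
proof -
  have "w $ x2 / w $ p2 \<in> {-1<..<1}" using assms(3) by (auto simp: field_simps abs_if split: if_splits)
  then obtain l where "tanh l = w $ x2 / w $ p2"
    by (metis ex_tanh)
  then have "w $ x2 * cosh l = w $ p2 * sinh l"
    using assms(3) by (auto simp: tanh_def field_simps)
  then show ?thesis using assms by (auto simp: flat_cone_iff)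
qed

lemma ruling_unique:
  assumes "y \<in> ruling l" "z \<in> ruling m" "y $ p2 \<noteq> 0" "y $ x2 = z $ x2" "y $ p2 = z $ p2"
  shows "l = m"
proof -
  have "tanh l = y $ x2 / y $ p2" "tanh m = y $ x2 / y $ p2"
    using assms by (auto simp: ruling_def tanh_def field_simps)
  then show ?thesis by (metis tanh_real_eq_iff)
qed

text \<open>
  Call the \<open>(x\<^sup>2, p\<^sup>2)\<close>-part of a vector hyperbolic. Some point of the line through \<open>y\<close> in
  direction \<open>z\<close> has no \<open>p\<^sup>2\<close>-component; as it lies in the cone, it has no hyperbolic part at
  all. So all hyperbolic parts on the line are parallel and determine the same parameter.
\<close>

lemma ruling_absorbs:
  assumes pencil: "\<And>t. y + t *\<^sub>R z \<in> flat_cone"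
    and z: "z \<in> ruling m" "z $ p2 \<noteq> 0"
  shows "y \<in> ruling m"
proof -
  define t where "t = - y $ p2 / z $ p2"
  \<comment> \<open>The point of the line without hyperbolic part; one step further along \<open>z\<close> the hyperbolic part is that of \<open>z\<close>.\<close>
  have "(y + t *\<^sub>R z) $ p2 = 0" using z by (simp add: t_def)
  with flat_cone_p2_zero[OF pencil this] have y: "y $ x2 = - t * z $ x2" "y $ p2 = - t * z $ p2" by auto
  obtain l where l: "y + (t + 1) *\<^sub>R z \<in> ruling l"
    using pencil by (auto simp: flat_cone_def)
  have "l = m"
    by (rule ruling_unique[OF l z(1)]) (use y z in \<open>auto simp: algebra_simps\<close>)
  then have "y + (t + 1) *\<^sub>R z - (t + 1) *\<^sub>R z \<in> ruling m"
    using l z by (intro subspace_diff subspace_scale subspace_ruling) auto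
  then show ?thesis by simp
qed

text \<open>
  The flat cone spans the whole space. This is what makes its linear automorphisms injective.
\<close>

lemma surj_if_covers_flat_cone:
  fixes L :: "real^4 \<Rightarrow> real^4"
  assumes "linear L" "flat_cone \<subseteq> range L"
  shows "surj L"
proof -
  have sub: "subspace (range L)" 
    using assms(1) by (simp add: linear_subspace_image)
  have in_cone: "axis x1 1 \<in> flat_cone" "axis p1 1 \<in> flat_cone" "axis p2 1 \<in> flat_cone"
    by (auto simp: flat_cone_iff axis_def intro: exI[of _ 0] exI[of _ "pi/2"])
  have "sinh 1 *\<^sub>R axis x2 1 + cosh 1 *\<^sub>R axis p2 1 \<in> flat_cone"
    by (auto simp: flat_cone_iff axis_def intro!: exI[of _ 1])
  then have "(1 / sinh 1) *\<^sub>R (sinh 1 *\<^sub>R axis x2 1 + cosh 1 *\<^sub>R axis p2 1 - cosh 1 *\<^sub>R axis p2 1) \<in> range L"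
    using in_cone assms(2) by (intro subspace_scale subspace_diff sub) auto
  then have "axis x2 1 \<in> range L" by simp
  with in_cone assms(2) have "axis i 1 \<in> range L" for i
    using exhaust_4[of i] by auto
  then have "span Basis \<subseteq> range L"
    by (intro span_minimal sub) (auto simp: Basis_vec_def)
  then show ?thesis by auto
qed

lemma dim_ruling: "dim (ruling l) \<le> 2"
proof -
  have "dim (ruling l) \<le> card {osc_vec l, hyp_vec l}"
    unfolding ruling_eq_span by (rule dim_le_card) auto
  also have "\<dots> \<le> 2" by (simp add: card_insert_if)
  finally show ?thesis .
qed

text \<open>
  The tangent plane of the factor with coordinates \<open>(x\<^sup>1, p\<^sup>1)\<close>. It belongs to the equation
  \<open>x'' = - x\<close>, whose solutions give the generators \<open>(sin l, cos l)\<close>.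
\<close>

definition oscillator_plane :: "(real^4) set" where
  "oscillator_plane = {w. w $ x2 = 0 \<and> w $ p2 = 0}"

lemma oscillator_plane: "subspace oscillator_plane" "dim oscillator_plane = 2"
proof -
  have eq: "oscillator_plane = span {axis x1 1, axis p1 1}"
  proof (intro set_eqI iffI)
    fix w assume "w \<in> oscillator_plane"
    then have "w = w $ x1 *\<^sub>R axis x1 1 + w $ p1 *\<^sub>R axis p1 1"
      by (simp add: oscillator_plane_def vec_eq_iff forall_4 axis_def)
    then show "w \<in> span {axis x1 1, axis p1 1}"
      by (metis insertCI span_add span_base span_scale)
  next
    fix w :: "real^4" assume "w \<in> span {axis x1 1, axis p1 1}"
    then obtain s t where "w = s *\<^sub>R axis x1 1 + t *\<^sub>R axis p1 1"
      by (auto simp: span_insert algebra_simps)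
    then show "w \<in> oscillator_plane"
      by (simp add: oscillator_plane_def axis_def)
  qed
  show "subspace oscillator_plane" by (simp add: eq)
  have "independent {axis x1 1, axis p1 1 :: real^4}"
    by (rule independent_mono[OF independent_Basis]) auto
  moreover have "axis x1 1 \<noteq> (axis p1 1 :: real^4)"
    by (simp add: axis_eq_axis)
  ultimately show "dim oscillator_plane = 2"
    unfolding eq by (simp add: dim_span_eq_card_independent del: dim_span)
qed

lemma ex_angle: "\<exists>l::real. a * cos l = b * sin l" 
proof (cases "b = 0")
  case True then show ?thesis by (intro exI[of _ "pi/2"]) simp
next
  case False
  then show ?thesis
    by (intro exI[of _ "arctan (a / b)"]) (use tan_arctan[of "a/b"] cos_arctan_not_zero[of "a/b"] in \<open>simp add: tan_def field_simps\<close>)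
qed

lemma ex_ruling: 
  assumes "w \<in> oscillator_plane" shows "\<exists>l. w \<in> ruling l"
  using assms ex_angle[of "w $ x1" "w $ p1"] by (auto simp: oscillator_plane_def ruling_def)

lemma oscillator_plane_subset: "oscillator_plane \<subseteq> flat_cone"
  using ex_ruling by (auto simp: flat_cone_def)

section \<open>Linear automorphisms of the flat cone\<close>

locale flat_cone_automorphism =
  fixes L :: "real^4 \<Rightarrow> real^4"
  assumes linear: "linear L" and image: "L ` flat_cone = flat_cone"
begin

lemma inj: "inj L"
proof (rule linear_surj_imp_inj[OF linear surj_if_covers_flat_cone[OF linear]])
  show "flat_cone \<subseteq> range L" using image by blast
qed

lemma in_cone: "w \<in> flat_cone \<Longrightarrow> L w \<in> flat_cone"
  using imageI[of w flat_cone L] by (simp add: image)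

lemma in_cone_iff: "L w \<in> flat_cone \<longleftrightarrow> w \<in> flat_cone"
  using inj_image_mem_iff[OF inj, of w flat_cone] by (simp add: image)

text \<open>
  The form in which \<open>ruling_absorbs\<close> is applied to an automorphism: the image of a plane of the
  cone is again a plane of the cone.
\<close>

lemma ruling_image:
  assumes V: "subspace V" "V \<subseteq> flat_cone" and yz: "y \<in> V" "z \<in> V" and m: "L z \<in> ruling m" "L z $ p2 \<noteq> 0"
  shows "L y \<in> ruling m"
proof (rule ruling_absorbs[OF _ m])
  fix t
  have "L (y + t *\<^sub>R z) \<in> flat_cone"
    by (intro in_cone subsetD[OF V(2)] subspace_add subspace_scale V(1) yz)
  then show "L y + t *\<^sub>R L z \<in> flat_cone"
    by (simp add: linear_add[OF linear] linear_scale[OF linear])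
qed

text \<open>
  The oscillator plane is the only plane of the cone that meets every other plane of the cone
  outside \<open>0\<close>. If its image left it, the image would be a ruling; but every vector of the
  oscillator plane lies in a further plane of the cone, and that plane would be carried into
  the same ruling, against injectivity.
\<close>

lemma oscillator_plane_image: "L ` oscillator_plane = oscillator_plane"
proof (rule subspace_dim_equal)
  note [simp] = oscillator_plane linear
  show dim: "dim oscillator_plane \<le> dim (L ` oscillator_plane)"
    using inj by (simp add: dim_image_eq inj_on_subset[OF inj])
  show "L ` oscillator_plane \<subseteq> oscillator_plane"
  proof (rule ccontr)
    assume "\<not> ?thesis"
    then obtain w where w: "w \<in> oscillator_plane" "L w \<notin> oscillator_plane" by blast
    have Lw: "L w \<in> flat_cone" "L w $ p2 \<noteq> 0"
      using in_cone[of w] w oscillator_plane_subset flat_cone_p2_zero[of "L w"]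
      by (auto simp: oscillator_plane_def)
    then obtain m where m: "L w \<in> ruling m" by (auto simp: flat_cone_def)
    have plane: "L ` oscillator_plane \<subseteq> ruling m"
      using ruling_image[OF oscillator_plane(1) oscillator_plane_subset _ w(1) m Lw(2)] by blast
    have eq: "L ` oscillator_plane = ruling m"
      by (rule subspace_dim_equal)
         (use plane dim dim_ruling[of m] in \<open>auto intro: linear_subspace_image subspace_ruling\<close>)
    obtain l where l: "w \<in> ruling l" using ex_ruling[OF w(1)] by blast
    have "hyp_vec l \<in> ruling l" by (simp add: hyp_vec_def ruling_def axis_def)
    then have "L (hyp_vec l) \<in> ruling m"
      using ruling_image[OF subspace_ruling, of l "hyp_vec l" w m] l m Lw by (auto simp: flat_cone_def)
    then have "hyp_vec l \<in> oscillator_plane"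
      using inj_image_mem_iff[OF inj, of "hyp_vec l" oscillator_plane] by (simp only: eq)
    then show False by (simp add: hyp_vec_def oscillator_plane_def axis_def)
  qed
  show "subspace (L ` oscillator_plane)"
    by (rule linear_subspace_image[OF linear oscillator_plane(1)])
qed (rule oscillator_plane(1))

lemma linear_simps [simp]: "L (x + y) = L x + L y" "L (x - y) = L x - L y" "L (c *\<^sub>R x) = c *\<^sub>R L x"
  by (rule linear_add[OF linear], rule linear_diff[OF linear], rule linear_scale[OF linear])

lemma generators: "osc_vec l \<in> ruling l" "hyp_vec l \<in> ruling l" "osc_vec l \<in> oscillator_plane"  "hyp_vec l \<notin> oscillator_plane"
  by (simp_all add: osc_vec_def hyp_vec_def ruling_def oscillator_plane_def axis_def)

lemma L_osc: "L (osc_vec l) $ x2 = 0" "L (osc_vec l) $ p2 = 0"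
proof -
  have "L (osc_vec l) \<in> oscillator_plane"
    using imageI[OF generators(3)[of l], of L] by (simp only: oscillator_plane_image)
  then show "L (osc_vec l) $ x2 = 0" "L (osc_vec l) $ p2 = 0"
    by (simp_all add: oscillator_plane_def)
qed

lemma L_hyp_p2: "L (hyp_vec l) $ p2 \<noteq> 0"
proof
  assume 0: "L (hyp_vec l) $ p2 = 0"
  have "L (hyp_vec l) \<in> flat_cone" by (intro in_cone ruling_subset[of _ l] generators)
  with 0 flat_cone_p2_zero have "L (hyp_vec l) \<in> oscillator_plane" by (auto simp: oscillator_plane_def)
  then have "hyp_vec l \<in> oscillator_plane" 
    using inj_image_mem_iff[OF inj, of "hyp_vec l" oscillator_plane] by (simp only: oscillator_plane_image)
  then show False using generators by blast
qed

text \<open>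
  The coupling of the two factors: the oscillator generator of a ruling has to go where the
  hyperbolic generator of the same ruling goes.
\<close>

lemma osc_follows_hyp:
  assumes "L (hyp_vec l) \<in> ruling m" shows "L (osc_vec l) \<in> ruling m"
  by (rule ruling_image[OF subspace_ruling _ generators(1,2) assms L_hyp_p2]) (auto simp: flat_cone_def)

lemma cross: "L (osc_vec l) $ x1 * L (hyp_vec l) $ p1 = L (osc_vec l) $ p1 * L (hyp_vec l) $ x1"
proof -
  have "L (hyp_vec l) \<in> flat_cone" by (intro in_cone ruling_subset[of _ l] generators)
  then obtain m where m: "L (hyp_vec l) \<in> ruling m" by (auto simp: flat_cone_def)
  then have "L (osc_vec l) $ x1 * cos m = L (osc_vec l) $ p1 * sin m" "L (hyp_vec l) $ x1 * cos m = L (hyp_vec l) $ p1 * sin m"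
    using osc_follows_hyp[OF m] by (auto simp: ruling_def)
  then have "(L (osc_vec l) $ x1 * L (hyp_vec l) $ p1 - L (osc_vec l) $ p1 * L (hyp_vec l) $ x1) * cos m = 0"
     "(L (osc_vec l) $ x1 * L (hyp_vec l) $ p1 - L (osc_vec l) $ p1 * L (hyp_vec l) $ x1) * sin m = 0"
    by algebra+
  then show ?thesis using sin_zero_abs_cos_one[of m] by (cases "sin m = 0") auto
qed

lemma L_osc_independent: "L (axis x1 1) $ x1 * L (axis p1 1) $ p1 \<noteq> L (axis x1 1) $ p1 * L (axis p1 1) $ x1"
proof
  define a1 a3 where "a1 = L (axis x1 1)" and "a3 = L (axis p1 1)"
  assume "L (axis x1 1) $ x1 * L (axis p1 1) $ p1 = L (axis x1 1) $ p1 * L (axis p1 1) $ x1"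
  then have c: "a1 $ x1 * a3 $ p1 = a1 $ p1 * a3 $ x1" by (simp add: a1_def a3_def)
  have z: "a1 $ x2 = 0" "a1 $ p2 = 0" "a3 $ x2 = 0" "a3 $ p2 = 0"
    using L_osc[of "pi/2"] L_osc[of 0] by (auto simp: a1_def a3_def osc_vec_def)
  have "L (a3 $ x1 *\<^sub>R axis x1 1 - a1 $ x1 *\<^sub>R axis p1 1) = 0" "L (a3 $ p1 *\<^sub>R axis x1 1 - a1 $ p1 *\<^sub>R axis p1 1) = 0"
    using c z by (auto simp: a1_def[symmetric] a3_def[symmetric] vec_eq_iff forall_4 mult.commute)
  then have "a3 $ x1 *\<^sub>R axis x1 1 - a1 $ x1 *\<^sub>R axis p1 1 = (0::real^4)" "a3 $ p1 *\<^sub>R axis x1 1 - a1 $ p1 *\<^sub>R axis p1 1 = (0::real^4)"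
    using inj linear by (blast dest: iffD1[OF linear_injective_0])+
  then have "a1 $ x1 = 0" "a1 $ p1 = 0"
    by (auto simp: vec_eq_iff forall_4 axis_def)
  then have "L (axis x1 1) = 0" using z by (auto simp: a1_def[symmetric] vec_eq_iff forall_4)
  then have "axis x1 1 = (0::real^4)"
    using inj linear by (blast dest: iffD1[OF linear_injective_0])
  then show False by simp
qed

text \<open>
  The hyperbolic plane is invariant as well. By \<open>cross\<close>, the oscillator part of the
  image of \<open>hyp_vec l\<close> is parallel to the image of \<open>osc_vec l\<close>. The parameters
  \<open>0\<close> and \<open>\<pi>\<close> give the same line of oscillator vectors but span the hyperbolic plane, so the
  oscillator part of the image of that whole plane lies in one line; the parameters
  \<open>\<pi>/2\<close> and \<open>- \<pi>/2\<close> put it into a second one.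
\<close>

lemma L_hyp: "L (axis x2 1) $ x1 = 0" "L (axis x2 1) $ p1 = 0" "L (axis p2 1) $ x1 = 0" "L (axis p2 1) $ p1 = 0"
proof -
  define a1 a2 a3 a4 where "a1 = L (axis x1 1)" and "a2 = L (axis x2 1)" and "a3 = L (axis p1 1)" and "a4 = L (axis p2 1)"
  note a = a1_def[symmetric] a2_def[symmetric] a3_def[symmetric] a4_def[symmetric]
  have nz: "a1 $ x1 * a3 $ p1 - a1 $ p1 * a3 $ x1 \<noteq> 0"
    using L_osc_independent by (simp add: a)
  have zero: "n $ x1 = 0 \<and> n $ p1 = 0" if "a1 $ x1 * n $ p1 = a1 $ p1 * n $ x1" "a3 $ x1 * n $ p1 = a3 $ p1 * n $ x1" for n :: "real^4"
  proof -
    have "(a1 $ x1 * a3 $ p1 - a1 $ p1 * a3 $ x1) * n $ x1 = 0" "(a1 $ x1 * a3 $ p1 - a1 $ p1 * a3 $ x1) * n $ p1 = 0"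
      using that by algebra+
    with nz show ?thesis by simp
  qed
  have c3: "a3 $ x1 * a4 $ p1 = a3 $ p1 * a4 $ x1"
    using cross[of 0] by (simp add: osc_vec_def hyp_vec_def a)
  have "a3 $ x1 * (sinh pi * a2 $ p1 + cosh pi * a4 $ p1) = a3 $ p1 * (sinh pi * a2 $ x1 + cosh pi * a4 $ x1)"
    using cross[of pi] by (simp add: osc_vec_def hyp_vec_def a linear_neg[OF linear])
  then have "sinh pi * (a3 $ x1 * a2 $ p1 - a3 $ p1 * a2 $ x1) = 0" using c3 by algebra
  then have c3': "a3 $ x1 * a2 $ p1 = a3 $ p1 * a2 $ x1" using pi_gt_zero by (simp del: pi_gt_zero)
  have k: "a1 $ x1 * (sinh (pi/2) * a2 $ p1 + cosh (pi/2) * a4 $ p1) = a1 $ p1 * (sinh (pi/2) * a2 $ x1 + cosh (pi/2) * a4 $ x1)"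
    "a1 $ x1 * (- sinh (pi/2) * a2 $ p1 + cosh (pi/2) * a4 $ p1) = a1 $ p1 * (- sinh (pi/2) * a2 $ x1 + cosh (pi/2) * a4 $ x1)"
    using cross[of "pi/2"] cross[of "-(pi/2)"] by (simp_all add: osc_vec_def hyp_vec_def a linear_neg[OF linear])
  then have "2 * sinh (pi/2) * (a1 $ x1 * a2 $ p1 - a1 $ p1 * a2 $ x1) = 0" "2 * cosh (pi/2) * (a1 $ x1 * a4 $ p1 - a1 $ p1 * a4 $ x1) = 0" 
    by algebra+
  then have c1: "a1 $ x1 * a2 $ p1 = a1 $ p1 * a2 $ x1" "a1 $ x1 * a4 $ p1 = a1 $ p1 * a4 $ x1" using pi_gt_zero by (simp_all del: pi_gt_zero)
  show "L (axis x2 1) $ x1 = 0" "L (axis x2 1) $ p1 = 0" "L (axis p2 1) $ x1 = 0" "L (axis p2 1) $ p1 = 0"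
    using zero[OF c1(1) c3'] zero[OF c1(2) c3] by (auto simp: a)
qed

lemma hyp_sector_image:
  assumes w: "w \<in> flat_cone" "w \<notin> oscillator_plane"
  shows "(L w $ x2)\<^sup>2 < (L w $ p2)\<^sup>2"
proof (rule flat_cone_timelike[OF in_cone[OF w(1)]])
  show "L w $ p2 \<noteq> 0"
  proof
    assume "L w $ p2 = 0"
    with in_cone[OF w(1)] have "L w \<in> oscillator_plane"
      by (simp add: flat_cone_p2_zero oscillator_plane_def)
    with inj_image_mem_iff[OF inj, of w oscillator_plane] w(2) show False
      unfolding oscillator_plane_image by blast
  qed
qed

text \<open>
  On the hyperbolic plane an automorphism preserves the sector \<open>\<bar>x\<^sup>2\<bar> < \<bar>p\<^sup>2\<bar>\<close> and its
  complement, so it preserves the Lorentz form \<open>(p\<^sup>2)\<^sup>2 - (x\<^sup>2)\<^sup>2\<close> up to a factor: it is a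
  multiple of a boost by \<open>m\<close>, composed with a reflection if \<open>s = -1\<close>.
\<close>

lemma hyp_block:
  obtains m b s where "b \<noteq> 0" "s = 1 \<or> s = -1"
    "L (axis p2 1) = b *\<^sub>R hyp_vec m" "L (axis x2 1) = (s * b) *\<^sub>R hyp_deriv_vec m"
proof -
  define a2 a4 where "a2 = L (axis x2 1)" and "a4 = L (axis p2 1)"
  note a = a2_def[symmetric] a4_def[symmetric]
  have z: "a2 $ x1 = 0" "a2 $ p1 = 0" "a4 $ x1 = 0" "a4 $ p1 = 0" using L_hyp by (simp_all add: a)
  \<comment> \<open>The Lorentz form of the image of \<open>(t, 1)\<close>.\<close>
  define Q where "Q t = (t * a2 $ p2 + a4 $ p2)\<^sup>2 - (t * a2 $ x2 + a4 $ x2)\<^sup>2" for t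
  have pos: "Q t > 0" if "t \<in> {-1<..<1}" for t
  proof -
    have "t *\<^sub>R axis x2 1 + axis p2 1 \<in> flat_cone"
      by (rule timelike_in_flat_cone) (use that in \<open>auto simp: axis_def\<close>)
    then have "(L (t *\<^sub>R axis x2 1 + axis p2 1) $ x2)\<^sup>2 < (L (t *\<^sub>R axis x2 1 + axis p2 1) $ p2)\<^sup>2"
      by (rule hyp_sector_image) (simp add: oscillator_plane_def axis_def)
    then show ?thesis by (simp add: Q_def a)
  qed
  \<comment> \<open>Null vectors are limits of the sector but do not belong to the cone, and the same holds for their images.\<close>
  have null: "Q t = 0" if t: "t = 1 \<or> t = -1" for t
  proof (rule antisym)
    have "t \<in> closure {-1<..<1}" using t by auto
    moreover have "continuous_on (closure {-1<..<1}) Q"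
      unfolding Q_def by (intro continuous_intros)
    ultimately show "0 \<le> Q t"
      by (metis continuous_ge_on_closure less_imp_le pos)
    show "Q t \<le> 0"
    proof (rule ccontr)
      let ?w = "t *\<^sub>R axis x2 1 + axis p2 (1::real)"
      assume "\<not> Q t \<le> 0"
      then have "(L ?w $ x2)\<^sup>2 < (L ?w $ p2)\<^sup>2" by (simp add: Q_def a)
      then have "L ?w \<in> flat_cone"
        by (intro timelike_in_flat_cone) (auto simp: a z abs_le_square_iff simp flip: not_le)
      then have "?w \<in> flat_cone" by (simp only: in_cone_iff)
      from flat_cone_timelike[OF this] show False
        using t by (auto simp: axis_def)
    qed
  qed
  have "a2 $ p2 * a2 $ p2 - a2 $ x2 * a2 $ x2 = - (a4 $ p2 * a4 $ p2 - a4 $ x2 * a4 $ x2)"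
    and orth: "a4 $ p2 * a2 $ p2 = a4 $ x2 * a2 $ x2"
    using null[of 1] null[of "-1"] by (simp_all add: Q_def power2_eq_square algebra_simps)
  note norm = this(1)
  have a4_nz: "a4 $ p2 \<noteq> 0"
    using pos[of 0] by (auto simp: Q_def)
  obtain m where m: "a4 $ x2 * cosh m = a4 $ p2 * sinh m"
    using in_cone[of "axis p2 1"] timelike_in_flat_cone[of "axis p2 1"] unfolding a
    by (auto simp: flat_cone_iff[of a4] axis_def)
  define b k where "b = a4 $ p2 / cosh m" and "k = a2 $ x2 / cosh m"
  have a4: "a4 $ p2 = b * cosh m" "a4 $ x2 = b * sinh m"
    using m by (simp_all add: b_def field_simps)
  then have b: "b \<noteq> 0" using a4_nz by auto
  have a2: "a2 $ x2 = k * cosh m" by (simp add: k_def)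
  have "b * cosh m * (a2 $ p2 - k * sinh m) = 0"
    using orth by (simp add: a4 a2 algebra_simps)
  then have a2': "a2 $ p2 = k * sinh m" using b by simp
  have "k * k * (cosh m * cosh m - sinh m * sinh m) = b * b * (cosh m * cosh m - sinh m * sinh m)"
    using norm unfolding a2 a2' a4 by algebra
  then have "k * k = b * b" by (simp add: cosh_sinh_sq)
  then obtain s where s: "s = 1 \<or> s = -1" "k = s * b"
    by (metis mult_1 mult_minus1 square_eq_iff)
  show thesis
  proof (rule that[OF b s(1)])
    show "L (axis p2 1) = b *\<^sub>R hyp_vec m" "L (axis x2 1) = (s * b) *\<^sub>R hyp_deriv_vec m"
      unfolding a using z a4 a2 a2' s by (simp_all add: vec_eq_iff forall_4 hyp_vec_def hyp_deriv_vec_def axis_def)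
  qed
qed

text \<open>
  Since \<open>hyp_vec l\<close> goes to a multiple of \<open>hyp_vec (m + s l)\<close>, the vector
  \<open>osc_vec l\<close> goes to a multiple of \<open>osc_vec (m + s l)\<close>. The values
  \<open>l = 0, \<pi>/2, \<pi>/4\<close> then force a conformal map with rotation angle equal to the boost
  parameter \<open>m\<close>.
\<close>

lemma normal_form:
  obtains m r b s where "r \<noteq> 0" "b \<noteq> 0" "s = 1 \<or> s = -1"
    "L (axis p1 1) = r *\<^sub>R osc_vec m" "L (axis x1 1) = (s * r) *\<^sub>R osc_vec (m + pi/2)"
    "L (axis p2 1) = b *\<^sub>R hyp_vec m" "L (axis x2 1) = (s * b) *\<^sub>R hyp_deriv_vec m"
proof -
  obtain m b s where b: "b \<noteq> 0" and s: "s = 1 \<or> s = -1"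
    and hyp: "L (axis p2 1) = b *\<^sub>R hyp_vec m" "L (axis x2 1) = (s * b) *\<^sub>R hyp_deriv_vec m"
    by (rule hyp_block)
  have "L (hyp_vec l) = b *\<^sub>R hyp_vec (m + s * l)" for l
    using s by (auto simp: hyp_vec_def[of l] hyp; simp add: hyp_vec_def hyp_deriv_vec_def vec_eq_iff forall_4 axis_def sinh_add cosh_add sinh_diff cosh_diff algebra_simps)
  then have "L (hyp_vec l) \<in> ruling (m + s * l)" for l
    by (simp add: subspace_scale subspace_ruling generators)
  then have "L (osc_vec l) \<in> ruling (m + s * l)" for l
    by (rule osc_follows_hyp)
  then have turn: "L (osc_vec l) $ x1 * cos (m + s * l) = L (osc_vec l) $ p1 * sin (m + s * l)" for l
    by (simp add: ruling_def)
  define a1 a3 where "a1 = L (axis x1 1)" and "a3 = L (axis p1 1)"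
  note a = a1_def[symmetric] a3_def[symmetric]
  have z: "a1 $ x2 = 0" "a1 $ p2 = 0" "a3 $ x2 = 0" "a3 $ p2 = 0"
    using L_osc[of "pi/2"] L_osc[of 0] by (auto simp: a osc_vec_def)
  \<comment> \<open>The coordinates of the two images along the frame turned by \<open>m\<close>.\<close>
  define r k where "r = a3 $ x1 * sin m + a3 $ p1 * cos m" and "k = a1 $ x1 * cos m - a1 $ p1 * sin m"
  have "a3 $ x1 * cos m = a3 $ p1 * sin m"
    using turn[of 0] by (simp add: osc_vec_def a)
  then have "r * sin m = a3 $ x1 * (sin m * sin m + cos m * cos m)" "r * cos m = a3 $ p1 * (sin m * sin m + cos m * cos m)"
    unfolding r_def by algebra+
  then have a3: "a3 $ x1 = r * sin m" "a3 $ p1 = r * cos m"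
    by (simp_all add: sin_cos_sq)
  have "a1 $ x1 * sin m = - a1 $ p1 * cos m"
    using turn[of "pi/2"] s by (auto simp: osc_vec_def a sin_add cos_add)
  then have "k * cos m = a1 $ x1 * (sin m * sin m + cos m * cos m)" "- k * sin m = a1 $ p1 * (sin m * sin m + cos m * cos m)"
    unfolding k_def by algebra+
  then have a1: "a1 $ x1 = k * cos m" "a1 $ p1 = - k * sin m"
    by (simp_all add: sin_cos_sq)
  \<comment> \<open>The images of the two axes are scaled equally because their sum also has a prescribed direction.\<close>
  have "cos (pi/4) = sin (pi/4)" "sin (pi/4) \<noteq> 0"
    by (simp_all add: sin_45 cos_45)
  then obtain c where c: "sin (pi/4) = c" "cos (pi/4) = c" "c \<noteq> 0"
    by blast
  have "c * c * ((a1 $ x1 + a3 $ x1) * (cos m - s * sin m)) = c * c * ((a1 $ p1 + a3 $ p1) * (sin m + s * cos m))"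
    using turn[of "pi/4"] s by (auto simp: osc_vec_def a sin_add cos_add c algebra_simps)
  with c(3) have "(a1 $ x1 + a3 $ x1) * (cos m - s * sin m) = (a1 $ p1 + a3 $ p1) * (sin m + s * cos m)"
    by simp
  then have "k * (sin m * sin m + cos m * cos m) = s * r * (sin m * sin m + cos m * cos m)"
    unfolding a1 a3 by algebra
  then have k: "k = s * r" by (simp add: sin_cos_sq)
  have "r \<noteq> 0"
  proof
    assume "r = 0"
    then have "L (axis p1 1) = 0" using a3 z by (simp add: a vec_eq_iff forall_4)
    then have "axis p1 1 = (0::real^4)"
      using inj linear by (blast dest: iffD1[OF linear_injective_0])
    then show False by simp
  qed
  show thesis
  proof (rule that[OF \<open>r \<noteq> 0\<close> b s _ _ hyp])
    show "L (axis p1 1) = r *\<^sub>R osc_vec m" "L (axis x1 1) = (s * r) *\<^sub>R osc_vec (m + pi/2)"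
      unfolding a using z a3 a1 k by (simp_all add: vec_eq_iff forall_4 osc_vec_def axis_def sin_add cos_add)
  qed
qed

end

text \<open>
  The shear turns an isomorphism from a cone of \<open>(u, v)\<close> to the flat cone into an automorphism
  of the flat cone. The terms with \<open>u\<^sub>p\<^sub>1\<close> and \<open>v\<^sub>p\<^sub>2\<close> come from inverting the shear.
\<close>

lemma cone_isomorphism_normal_form:
  fixes J :: "real^4 \<Rightarrow> real^4"
  assumes J: "linear J" "J ` cone_structure u v q = cone_structure (\<lambda>_. 0) (\<lambda>_. 0) q'"
    and "\<partial> p2 u q = 0" "\<partial> p1 v q = 0"
  obtains m r b s where "r \<noteq> 0" "b \<noteq> 0" "s = 1 \<or> s = -1"
    "J (axis p1 1) = r *\<^sub>R osc_vec m"
    "J (axis x1 1) = (s * r) *\<^sub>R osc_vec (m + pi/2) - (\<partial> p1 u q * r) *\<^sub>R osc_vec m"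
    "J (axis p2 1) = b *\<^sub>R hyp_vec m"
    "J (axis x2 1) = (s * b) *\<^sub>R hyp_deriv_vec m - (\<partial> p2 v q * b) *\<^sub>R hyp_vec m"
proof -
  define S where "S = shear (\<partial> p1 u q) (\<partial> p2 v q)"
  have S: "linear S"
    by (rule linearI) (auto simp: S_def algebra_simps)
  have "\<partial> i (\<lambda>_. 0) p = 0" for i p
    by (rule partial_deriv_cong_zero) simp
  then have flat: "cone_structure (\<lambda>_. 0) (\<lambda>_. 0) q' = flat_cone"
    by (simp add: cone_structure_eq_shear)
  interpret flat_cone_automorphism "J \<circ> S"
  proof (rule flat_cone_automorphism.intro)
    show "linear (J \<circ> S)" by (rule linear_compose[OF S J(1)])
    show "(J \<circ> S) ` flat_cone = flat_cone"
      using J(2) unfolding flat cone_structure_eq_shear[OF assms(3,4)] S_def[symmetric] image_comp .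
  qed
  have S_axis: "S (axis p1 1) = axis p1 1" "S (axis p2 1) = axis p2 1"
    "S (axis x1 1) = axis x1 1 + \<partial> p1 u q *\<^sub>R axis p1 1" "S (axis x2 1) = axis x2 1 + \<partial> p2 v q *\<^sub>R axis p2 1"
    by (simp_all add: S_def vec_eq_iff forall_4 axis_def)
  note J_simps = linear_add[OF J(1)] linear_scale[OF J(1)]
  obtain m r b s where nf: "r \<noteq> 0" "b \<noteq> 0" "s = 1 \<or> s = -1"
    "(J \<circ> S) (axis p1 1) = r *\<^sub>R osc_vec m" "(J \<circ> S) (axis x1 1) = (s * r) *\<^sub>R osc_vec (m + pi/2)"
    "(J \<circ> S) (axis p2 1) = b *\<^sub>R hyp_vec m" "(J \<circ> S) (axis x2 1) = (s * b) *\<^sub>R hyp_deriv_vec m"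
    by (rule normal_form)
  show thesis
    by (rule that[of r b s m])
       (use nf in \<open>simp_all add: S_axis J_simps eq_diff_eq\<close>)
qed

section \<open>Conformal maps of the plane\<close>

text \<open>
  Why conformal flatness of the frame \<open>\<partial>\<^sub>p, \<partial>\<^sub>x + a \<partial>\<^sub>p\<close> in the plane, with its
  directions turned by a constant angle, makes \<open>a\<close> affine in \<open>p\<close>. Take \<open>F\<close> and \<open>H\<close> as
  coordinates of the target along the images of \<open>\<partial>\<^sub>p\<close> and \<open>\<partial>\<^sub>x + a \<partial>\<^sub>p\<close>. Then \<open>H\<close> does not
  depend on \<open>p\<close>, hence neither does \<open>H\<^sub>x\<close>, which is the conformal factor \<open>\<rho>\<close> up to sign. So
  \<open>F = F(x, 0) + \<rho>(x) p\<close>, and comparing \<open>F\<^sub>x = - a \<rho>\<close> at \<open>p\<close> and at \<open>0\<close> gives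
  \<open>(a(x, p) - a(x, 0)) \<rho>(x) = - \<rho>'(x) p\<close>.
\<close>

lemma affine_coefficient:
  fixes F H \<rho> \<sigma> a :: "real \<Rightarrow> real \<Rightarrow> real"
  assumes d: "0 < d"
    and Fp: "\<And>x p. \<bar>x\<bar> < d \<Longrightarrow> \<bar>p\<bar> < d \<Longrightarrow> (F x has_real_derivative \<rho> x p) (at p)"
    and Fx: "\<And>x p. \<bar>x\<bar> < d \<Longrightarrow> \<bar>p\<bar> < d \<Longrightarrow> ((\<lambda>x. F x p) has_real_derivative - a x p * \<rho> x p) (at x)"
    and Hp: "\<And>x p. \<bar>x\<bar> < d \<Longrightarrow> \<bar>p\<bar> < d \<Longrightarrow> (H x has_real_derivative 0) (at p)"
    and Hx: "\<And>x p. \<bar>x\<bar> < d \<Longrightarrow> \<bar>p\<bar> < d \<Longrightarrow> ((\<lambda>x. H x p) has_real_derivative \<sigma> x p) (at x)"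
    and \<sigma>: "\<And>x p. \<bar>x\<bar> < d \<Longrightarrow> \<bar>p\<bar> < d \<Longrightarrow> (\<sigma> x p)\<^sup>2 = (\<rho> x p)\<^sup>2"
    and \<rho>0: "\<And>x p. \<bar>x\<bar> < d \<Longrightarrow> \<bar>p\<bar> < d \<Longrightarrow> \<rho> x p \<noteq> 0"
    and cont: "\<And>x. \<bar>x\<bar> < d \<Longrightarrow> continuous_on {-d<..<d} (\<rho> x)"
  shows "\<exists>c. \<forall>p. \<bar>p\<bar> < d \<longrightarrow> a 0 p = a 0 0 + c * p"
proof -
  have H0: "H x p = H x 0" if "\<bar>x\<bar> < d" "\<bar>p\<bar> < d" for x p
  proof -
    have "\<exists>c. \<forall>p\<in>{-d<..<d}. H x p = c"
      by (rule has_field_derivative_zero_constant)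
         (use Hp[OF that(1)] in \<open>auto intro: has_field_derivative_at_within\<close>)
    then obtain c where "\<And>p. p \<in> {-d<..<d} \<Longrightarrow> H x p = c" by blast
    from this[of p] this[of 0] show ?thesis
      using d that by (auto simp: abs_less_iff)
  qed
  have \<sigma>0: "\<sigma> x p = \<sigma> x 0" if "\<bar>x\<bar> < d" "\<bar>p\<bar> < d" for x p
  proof -
    have "((\<lambda>x. H x 0) has_real_derivative \<sigma> x p) (at x)"
      using Hx[OF that] by (rule has_field_derivative_transform_within_open[where S = "{-d<..<d}"])
        (use that H0[of _ p] in auto)
    moreover have "((\<lambda>x. H x 0) has_real_derivative \<sigma> x 0) (at x)"
      using Hx[of x 0] that d by simp
    ultimately show ?thesis
      by (rule DERIV_unique)
  qed
  have \<rho>_const: "\<rho> x p = \<rho> x 0" if x: "\<bar>x\<bar> < d" and p: "\<bar>p\<bar> < d" for x p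
  proof -
    \<comment> \<open>The square of \<open>\<rho>\<close> is independent of \<open>p\<close>; the sign cannot jump by continuity.\<close>
    have "\<rho> x p \<in> {\<rho> x 0, - \<rho> x 0}" if "p \<in> {-d<..<d}" for p
      using \<sigma>[of x p] \<sigma>[of x 0] \<sigma>0[of x p] x that d
      by (auto simp: power2_eq_iff)
    then have fin: "finite (\<rho> x ` {-d<..<d})"
      by (meson finite.simps finite_subset image_subsetI)
    have "\<rho> x constant_on {-d<..<d}"
      by (rule continuous_finite_range_constant[OF _ cont[OF x] fin]) simp
    then show ?thesis
      using d p by (force simp: constant_on_def)
  qed
  have F_affine: "F x p = F x 0 + \<rho> x 0 * p" if x: "\<bar>x\<bar> < d" and p: "\<bar>p\<bar> < d" for x p
  proof -
    have "\<exists>c. \<forall>p\<in>{-d<..<d}. F x p - \<rho> x 0 * p = c"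
    proof (rule has_field_derivative_zero_constant)
      fix p assume "p \<in> {-d<..<d}"
      then have "((\<lambda>p. F x p - \<rho> x 0 * p) has_real_derivative \<rho> x p - \<rho> x 0) (at p)"
        by (auto intro!: derivative_eq_intros Fp x)
      moreover have "\<rho> x p - \<rho> x 0 = 0"
        using \<rho>_const[OF x, of p] \<open>p \<in> _\<close> by auto
      ultimately show "((\<lambda>p. F x p - \<rho> x 0 * p) has_real_derivative 0) (at p within {-d<..<d})"
        by (simp add: has_field_derivative_at_within)
    qed simp
    then obtain c where "\<And>p. p \<in> {-d<..<d} \<Longrightarrow> F x p - \<rho> x 0 * p = c" by blast
    from this[of p] this[of 0] show ?thesis
      using d p by (simp add: abs_less_iff algebra_simps)
  qed
  \<comment> \<open>Differentiability of \<open>\<rho>\<close> in \<open>x\<close> comes for free, because \<open>\<rho>\<close> is a difference quotient of \<open>F\<close> in \<open>p\<close>.\<close>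
  define h where "h = d / 2"
  have h: "0 < h" "\<bar>h\<bar> < d" using d by (auto simp: h_def)
  have slope: "((\<lambda>x. \<rho> x 0) has_real_derivative (- a 0 h * \<rho> 0 h + a 0 0 * \<rho> 0 0) / h) (at 0)" 
  proof -
    have "((\<lambda>x. (F x h - F x 0) / h) has_real_derivative (- a 0 h * \<rho> 0 h + a 0 0 * \<rho> 0 0) / h) (at 0)"
      using Fx[of 0 h] Fx[of 0 0] h d by (auto intro!: derivative_eq_intros)
    then show ?thesis
      by (rule has_field_derivative_transform_within_open[where S = "{-d<..<d}"])
        (use d h F_affine[of _ h] in auto)
  qed
  then obtain D where D: "((\<lambda>x. \<rho> x 0) has_real_derivative D) (at 0)" by blast
  have "a 0 p = a 0 0 + (- D / \<rho> 0 0) * p" if p: "\<bar>p\<bar> < d" for p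
  proof -
    have "((\<lambda>x. F x 0 + \<rho> x 0 * p) has_real_derivative - a 0 0 * \<rho> 0 0 + D * p) (at 0)"
      using Fx[of 0 0] D d by (auto intro!: derivative_eq_intros)
    moreover have "((\<lambda>x. F x 0 + \<rho> x 0 * p) has_real_derivative - a 0 p * \<rho> 0 p) (at 0)"
      by (rule has_field_derivative_transform_within_open[OF Fx, where S = "{-d<..<d}"])
        (use d p F_affine[of _ p] in auto)
    ultimately have "- a 0 p * \<rho> 0 0 = - a 0 0 * \<rho> 0 0 + D * p"
      using DERIV_unique \<rho>_const[of 0 p] d p by fastforce
    moreover have "\<rho> 0 0 \<noteq> 0" using \<rho>0 d by simp
    ultimately show ?thesis
      by (auto simp: field_simps)
  qed
  then show ?thesis by blast
qed

section \<open>Maps with block diagonal derivative\<close>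

lemma line_derivative:
  fixes \<phi> :: "'a::real_normed_vector \<Rightarrow> 'b::real_inner"
  assumes "\<phi> differentiable at (q + t *\<^sub>R w)"
  shows "((\<lambda>t. \<phi> (q + t *\<^sub>R w) \<bullet> c) has_real_derivative frechet_derivative \<phi> (at (q + t *\<^sub>R w)) w \<bullet> c) (at t)"
proof -
  let ?J = "frechet_derivative \<phi> (at (q + t *\<^sub>R w))"
  have J: "(\<phi> has_derivative ?J) (at (q + t *\<^sub>R w))"
    using assms by (simp add: frechet_derivative_works)
  have "((\<lambda>t. q + t *\<^sub>R w) has_derivative (\<lambda>h. h *\<^sub>R w)) (at t)"
    by (auto intro!: derivative_eq_intros)
  from has_derivative_compose[OF this J]
  have "((\<lambda>t. \<phi> (q + t *\<^sub>R w) \<bullet> c) has_derivative (\<lambda>h. ?J (h *\<^sub>R w) \<bullet> c)) (at t)"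
    by (rule has_derivative_inner_left)
  moreover have "?J (h *\<^sub>R w) \<bullet> c = (?J w \<bullet> c) * h" for h
    using linear_scale[OF has_derivative_linear[OF J]] by simp
  ultimately show ?thesis
    by (simp add: has_field_derivative_def)
qed

text \<open>
  Only the \<open>c\<close>-component of \<open>\<phi>\<close> is controlled, so this is a statement about one component of
  a map whose derivative is block diagonal.
\<close>

lemma constant_along:
  fixes \<phi> :: "'a::real_normed_vector \<Rightarrow> 'b::real_inner"
  assumes S: "convex S" "\<And>x. x \<in> S \<Longrightarrow> \<phi> differentiable at x"
    and zero: "\<And>x. x \<in> S \<Longrightarrow> frechet_derivative \<phi> (at x) d \<bullet> c = 0"
    and q: "q \<in> S" "q + d \<in> S"
  shows "\<phi> (q + d) \<bullet> c = \<phi> q \<bullet> c"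
proof -
  have seg: "q + t *\<^sub>R d \<in> S" if "t \<in> {0..1}" for t
  proof -
    have "(1 - t) *\<^sub>R q + t *\<^sub>R (q + d) \<in> S"
      using S(1) q that by (auto simp: convex_alt)
    then show ?thesis by (simp add: algebra_simps)
  qed
  have "\<exists>k. \<forall>t\<in>{0..1}. \<phi> (q + t *\<^sub>R d) \<bullet> c = k"
  proof (rule has_field_derivative_zero_constant)
    fix t :: real assume "t \<in> {0..1}"
    then show "((\<lambda>t. \<phi> (q + t *\<^sub>R d) \<bullet> c) has_real_derivative 0) (at t within {0..1})"
      using line_derivative[OF S(2)[OF seg], of t c] zero[OF seg, of t]
      by (simp add: has_field_derivative_at_within)
  qed simp
  then obtain k where k: "\<And>t. t \<in> {0..1} \<Longrightarrow> \<phi> (q + t *\<^sub>R d) \<bullet> c = k" by blast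
  show ?thesis using k[of 0] k[of 1] by simp
qed

text \<open>
  By \<open>constant_along\<close> the component takes the same values near \<open>q\<close> and near \<open>q + d\<close>. For a
  map of product form this says that the derivative in one factor is the same at all points
  of the other factor.
\<close>

lemma derivative_shift:
  fixes \<phi> :: "'a::real_normed_vector \<Rightarrow> 'b::real_inner"
  assumes S: "open S" "convex S" "\<And>x. x \<in> S \<Longrightarrow> \<phi> differentiable at x"
    and zero: "\<And>x. x \<in> S \<Longrightarrow> frechet_derivative \<phi> (at x) d \<bullet> c = 0"
    and q: "q \<in> S" "q + d \<in> S"
  shows "frechet_derivative \<phi> (at (q + d)) w \<bullet> c = frechet_derivative \<phi> (at q) w \<bullet> c"
proof -
  have ev: "\<forall>\<^sub>F t in nhds 0. x + t *\<^sub>R w \<in> S" if "x \<in> S" for x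
  proof -
    have "((\<lambda>t. x + t *\<^sub>R w) \<longlongrightarrow> x + 0 *\<^sub>R w) (nhds 0)"
      by (intro tendsto_intros filterlim_ident)
    then show ?thesis
      using that S(1) by (auto intro: topological_tendstoD)
  qed
  have "\<forall>\<^sub>F t in nhds 0. \<phi> (q + t *\<^sub>R w) \<bullet> c = \<phi> (q + d + t *\<^sub>R w) \<bullet> c"
    using ev[OF q(1)] ev[OF q(2)]
  proof eventually_elim
    case (elim t)
    then show ?case
      using constant_along[OF S(2,3) zero, of "q + t *\<^sub>R w"] by (simp add: algebra_simps)
  qed
  moreover have "((\<lambda>t. \<phi> (q + t *\<^sub>R w) \<bullet> c) has_real_derivative frechet_derivative \<phi> (at q) w \<bullet> c) (at 0)"
    using line_derivative[of \<phi> q 0 w c] S(3)[OF q(1)] by simp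
  ultimately have "((\<lambda>t. \<phi> (q + d + t *\<^sub>R w) \<bullet> c) has_real_derivative frechet_derivative \<phi> (at q) w \<bullet> c) (at 0)"
    by (simp add: DERIV_cong_ev)
  moreover have "((\<lambda>t. \<phi> (q + d + t *\<^sub>R w) \<bullet> c) has_real_derivative frechet_derivative \<phi> (at (q + d)) w \<bullet> c) (at 0)"
    using line_derivative[of \<phi> "q + d" 0 w c] S(3)[OF q(2)] by simp
  ultimately show ?thesis
    by (rule DERIV_unique[symmetric])
qed

text \<open>
  The planar argument on the slice through \<open>q0\<close> in the directions \<open>i\<close> and \<open>j\<close>: pairing \<open>\<phi>\<close>
  with the fixed vectors \<open>c\<close> and \<open>d\<close> produces the functions \<open>F\<close> and \<open>H\<close> of
  \<open>affine_coefficient\<close>.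
\<close>

lemma coefficient_second_derivative_zero:
  fixes \<phi> :: "real^4 \<Rightarrow> 'b::real_inner" and a :: "real^4 \<Rightarrow> real"
  defines "J \<equiv> (\<lambda>q. frechet_derivative \<phi> (at q))"
  assumes D: "open D" "q0 \<in> D"
    and diff: "\<And>q. q \<in> D \<Longrightarrow> \<phi> differentiable at q"
    and cont: "continuous_on D (\<lambda>q. J q (axis j 1) \<bullet> c)"
    and eqs: "\<And>s t. q0 + s *\<^sub>R axis i 1 + t *\<^sub>R axis j 1 \<in> D \<Longrightarrow> 
       let q = q0 + s *\<^sub>R axis i 1 + t *\<^sub>R axis j 1 in
         J q (axis j 1) \<bullet> c \<noteq> 0 \<and>
         J q (axis i 1) \<bullet> c = - a q * (J q (axis j 1) \<bullet> c) \<and>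
         J q (axis j 1) \<bullet> d = 0 \<and>
         (J q (axis i 1) \<bullet> d)\<^sup>2 = (J q (axis j 1) \<bullet> c)\<^sup>2"
  shows "\<partial> j (\<partial> j a) q0 = 0"
proof -
  obtain e where e: "e > 0" "ball q0 e \<subseteq> D"
    using D openE by blast
  define \<delta> where "\<delta> = e / 2"
  define pt where "pt x p = q0 + x *\<^sub>R axis i 1 + p *\<^sub>R axis j (1::real)" for x p
  have \<delta>: "\<delta> > 0" using e by (simp add: \<delta>_def)
  have pt_D: "pt x p \<in> D" if "\<bar>x\<bar> < \<delta>" "\<bar>p\<bar> < \<delta>" for x p
  proof -
    have "dist q0 (pt x p) = norm (x *\<^sub>R axis i (1::real) + p *\<^sub>R axis j 1)"
      by (simp add: pt_def dist_norm norm_minus_commute add_ac)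
    also have "\<dots> \<le> \<bar>x\<bar> + \<bar>p\<bar>"
      by (rule norm_triangle_le) (simp add: norm_axis_1)
    also have "\<dots> < e" using that by (simp add: \<delta>_def)
    finally show ?thesis using e(2) by auto
  qed
  note E = eqs[folded pt_def, unfolded Let_def, OF pt_D]
  have "\<exists>k. \<forall>p. \<bar>p\<bar> < \<delta> \<longrightarrow> a (pt 0 p) = a (pt 0 0) + k * p"
  proof (rule affine_coefficient[where F = "\<lambda>x p. \<phi> (pt x p) \<bullet> c" and H = "\<lambda>x p. \<phi> (pt x p) \<bullet> d"
        and \<rho> = "\<lambda>x p. J (pt x p) (axis j 1) \<bullet> c" and \<sigma> = "\<lambda>x p. J (pt x p) (axis i 1) \<bullet> d", OF \<delta>])
    fix x p assume xp: "\<bar>x\<bar> < \<delta>" "\<bar>p\<bar> < \<delta>"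
    have dp: "((\<lambda>p. \<phi> (pt x p) \<bullet> w) has_real_derivative J (pt x p) (axis j 1) \<bullet> w) (at p)" for w
      using line_derivative[of \<phi> "q0 + x *\<^sub>R axis i 1" p "axis j 1" w] diff[OF pt_D[OF xp]]
      by (simp add: pt_def J_def)
    have "pt x p = (q0 + p *\<^sub>R axis j 1) + x *\<^sub>R axis i 1" for x p
      by (simp add: pt_def algebra_simps)
    then have dx: "((\<lambda>x. \<phi> (pt x p) \<bullet> w) has_real_derivative J (pt x p) (axis i 1) \<bullet> w) (at x)" for w
      using line_derivative[of \<phi> "q0 + p *\<^sub>R axis j 1" x "axis i 1" w] diff[OF pt_D[OF xp]]
      by (simp add: J_def)
    show "((\<lambda>p. \<phi> (pt x p) \<bullet> c) has_real_derivative J (pt x p) (axis j 1) \<bullet> c) (at p)" by (rule dp)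
    show "((\<lambda>x. \<phi> (pt x p) \<bullet> c) has_real_derivative - a (pt x p) * (J (pt x p) (axis j 1) \<bullet> c)) (at x)"
      using dx[of c] E[OF xp] by metis
    show "((\<lambda>p. \<phi> (pt x p) \<bullet> d) has_real_derivative 0) (at p)"
      using dp[of d] E[OF xp] by metis
    show "((\<lambda>x. \<phi> (pt x p) \<bullet> d) has_real_derivative J (pt x p) (axis i 1) \<bullet> d) (at x)" by (rule dx)
    show "(J (pt x p) (axis i 1) \<bullet> d)\<^sup>2 = (J (pt x p) (axis j 1) \<bullet> c)\<^sup>2"
      "J (pt x p) (axis j 1) \<bullet> c \<noteq> 0"
      using E[OF xp] by blast+
  next
    fix x assume x: "\<bar>x\<bar> < \<delta>"
    show "continuous_on {-\<delta><..<\<delta>} (\<lambda>p. J (pt x p) (axis j 1) \<bullet> c)"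
      by (rule continuous_on_compose2[OF cont])
         (auto simp: pt_def intro!: continuous_intros pt_D[unfolded pt_def] x)
  qed
  then obtain k where k: "\<And>p. \<bar>p\<bar> < \<delta> \<Longrightarrow> a (q0 + p *\<^sub>R axis j 1) = a q0 + k * p"
    by (auto simp: pt_def)
  have near: "\<forall>\<^sub>F p in nhds p0. \<bar>p\<bar> < \<delta>" if "\<bar>p0\<bar> < \<delta>" for p0 :: real
    by (rule eventually_nhds_in_open[of "{-\<delta><..<\<delta>}" p0, THEN eventually_mono]) (use that in auto)
  have slope: "\<partial> j a (q0 + p *\<^sub>R axis j 1) = k" if p: "\<bar>p\<bar> < \<delta>" for p
  proof -
    have "\<forall>\<^sub>F t in nhds 0. \<bar>t\<bar> < \<delta> - \<bar>p\<bar>"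
      by (rule eventually_nhds_in_open[of "{-(\<delta> - \<bar>p\<bar>)<..<\<delta> - \<bar>p\<bar>}" 0, THEN eventually_mono]) (use p in auto)
    then have "\<forall>\<^sub>F t in nhds 0. a (q0 + p *\<^sub>R axis j 1 + t *\<^sub>R axis j 1) = a q0 + k * (p + t)"
    proof eventually_elim
      case (elim t)
      then have "\<bar>p + t\<bar> < \<delta>" by linarith
      from k[OF this] show ?case by (simp add: algebra_simps)
    qed
    then have "\<partial> j a (q0 + p *\<^sub>R axis j 1) = deriv (\<lambda>t. a q0 + k * (p + t)) 0"
      unfolding partial_deriv_def by (rule deriv_cong_ev) simp
    also have "\<dots> = k"
      by (rule DERIV_imp_deriv) (auto intro!: derivative_eq_intros)
    finally show ?thesis .
  qed
  have "\<forall>\<^sub>F t in nhds 0. \<partial> j a (q0 + t *\<^sub>R axis j 1) = k"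
    using near[of 0] \<delta> by (auto elim!: eventually_mono intro: slope)
  then have "\<partial> j (\<partial> j a) q0 = deriv (\<lambda>t. k) 0"
    unfolding partial_deriv_def by (rule deriv_cong_ev) simp
  then show ?thesis by simp
qed

section \<open>Diffeomorphisms to the flat structure\<close>

text \<open>
  The vectors \<open>hyp_vec (- m)\<close> and \<open>hyp_deriv_vec (- m)\<close> form the frame dual to
  \<open>hyp_vec m\<close> and \<open>hyp_deriv_vec m\<close> for the Euclidean inner product; the oscillator frame is
  its own dual.
\<close>

lemma tangent_vec_inner:
  "osc_vec m \<bullet> osc_vec m = 1" "osc_vec m \<bullet> osc_vec (m + pi/2) = 0"
  "osc_vec (m + pi/2) \<bullet> osc_vec m = 0" "osc_vec (m + pi/2) \<bullet> osc_vec (m + pi/2) = 1"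
  "hyp_vec m \<bullet> hyp_vec (- m) = 1" "hyp_deriv_vec m \<bullet> hyp_vec (- m) = 0"
  "hyp_vec m \<bullet> hyp_deriv_vec (- m) = 0" "hyp_deriv_vec m \<bullet> hyp_deriv_vec (- m) = 1"
  by (simp_all add: inner_vec_def sum_4 osc_vec_def hyp_vec_def hyp_deriv_vec_def axis_def
      sin_add cos_add sin_cos_sq cosh_sinh_sq)

lemma hyp_vec_direction_inj:
  assumes "b *\<^sub>R hyp_vec m = b' *\<^sub>R hyp_vec m'" "b \<noteq> 0"
  shows "m = m'"
proof (rule ruling_unique[of "b *\<^sub>R hyp_vec m" m "b' *\<^sub>R hyp_vec m'" m'])
  show "b *\<^sub>R hyp_vec m \<in> ruling m" "b' *\<^sub>R hyp_vec m' \<in> ruling m'"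
    by (simp_all add: ruling_def tangent_vec_nth)
  show "(b *\<^sub>R hyp_vec m) $ p2 \<noteq> 0"
    using assms(2) by (simp add: tangent_vec_nth)
qed (simp_all only: assms(1))

lemma osc_vec_direction_inj:
  assumes "r *\<^sub>R osc_vec m = r' *\<^sub>R osc_vec m'" "r \<noteq> 0" "\<bar>m - m'\<bar> < pi"
  shows "m = m'"
proof -
  have "r * sin m = r' * sin m'" "r * cos m = r' * cos m'"
    using assms(1) by (auto simp: tangent_vec_nth vec_eq_iff forall_4)
  then have "r * sin (m - m') = 0"
    by (simp add: sin_diff) algebra
  then show ?thesis
    using assms(2,3) sin_zero_pi_iff by auto
qed

text \<open>
  The rotation angle in the first factor equals the boost parameter in the second. One depends
  only on \<open>(x\<^sup>1, p\<^sup>1)\<close> and the other only on \<open>(x\<^sup>2, p\<^sup>2)\<close>, so both are constant. As the angle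
  is visible only modulo \<open>\<pi>\<close>, this needs a neighbourhood on which \<open>m\<close> varies by less than
  \<open>\<pi>\<close>. With \<open>m\<close> constant, pairing with the frame dual to the one it determines gives
  the planar equations in each factor.
\<close>

lemma third_derivatives_vanish_if_flat:
  fixes u v :: "real^4 \<Rightarrow> real" and \<phi> :: "real^4 \<Rightarrow> real^4"
  assumes M: "open M" "q0 \<in> M" and \<phi>: "smooth_on M \<phi>"
    and cones: "\<And>q. q \<in> M \<Longrightarrow> frechet_derivative \<phi> (at q) ` cone_structure u v q
                   = cone_structure (\<lambda>_. 0) (\<lambda>_. 0) (\<phi> q)"
    and uv: "\<And>q. \<partial> p2 u q = 0" "\<And>q. \<partial> p1 v q = 0"
  shows "\<partial> p1 (\<partial> p1 (\<partial> p1 u)) q0 = 0 \<and> \<partial> p2 (\<partial> p2 (\<partial> p2 v)) q0 = 0"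
proof -
  define J where "J q = frechet_derivative \<phi> (at q)" for q
  have "higher_differentiable_on M \<phi> (Suc 0)"
    using \<phi> by (simp add: smooth_on_def)
  then have diff: "\<And>q. q \<in> M \<Longrightarrow> \<phi> differentiable at q"
    and cont: "\<And>w. continuous_on M (\<lambda>q. J q w)"
    by (simp_all add: higher_differentiable_on.simps J_def)
  define NF where "NF q m r b s \<longleftrightarrow> (r \<noteq> 0 \<and> b \<noteq> 0 \<and> (s = 1 \<or> s = -1)) \<and>
    J q (axis p1 1) = r *\<^sub>R osc_vec m \<and>
    J q (axis x1 1) = (s * r) *\<^sub>R osc_vec (m + pi/2) - (\<partial> p1 u q * r) *\<^sub>R osc_vec m \<and>
    J q (axis p2 1) = b *\<^sub>R hyp_vec m \<and>
    J q (axis x2 1) = (s * b) *\<^sub>R hyp_deriv_vec m - (\<partial> p2 v q * b) *\<^sub>R hyp_vec m"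
    for q m r b s
  have "\<exists>m r b s. NF q m r b s" if q: "q \<in> M" for q
  proof -
    have "linear (J q)"
      using diff[OF q] by (simp add: J_def linear_frechet_derivative)
    then obtain r b s m where "NF q m r b s"
      unfolding NF_def
      by (rule cone_isomorphism_normal_form[OF _ cones[OF q, folded J_def] uv]) blast
    then show ?thesis by blast
  qed
  then obtain m r b s where "\<And>q. q \<in> M \<Longrightarrow> NF q (m q) (r q) (b q) (s q)"
    by metis
  then have nf: "\<And>q. q \<in> M \<Longrightarrow> r q \<noteq> 0 \<and> b q \<noteq> 0 \<and> (s q = 1 \<or> s q = -1)"
    and J_p1: "\<And>q. q \<in> M \<Longrightarrow> J q (axis p1 1) = r q *\<^sub>R osc_vec (m q)"
    and J_x1: "\<And>q. q \<in> M \<Longrightarrow> J q (axis x1 1) = (s q * r q) *\<^sub>R osc_vec (m q + pi/2) - (\<partial> p1 u q * r q) *\<^sub>R osc_vec (m q)"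
    and J_p2: "\<And>q. q \<in> M \<Longrightarrow> J q (axis p2 1) = b q *\<^sub>R hyp_vec (m q)"
    and J_x2: "\<And>q. q \<in> M \<Longrightarrow> J q (axis x2 1) = (s q * b q) *\<^sub>R hyp_deriv_vec (m q) - (\<partial> p2 v q * b q) *\<^sub>R hyp_vec (m q)"
    unfolding NF_def by blast+
  \<comment> \<open>The parameter can be read off the hyperbolic block, so it is continuous.\<close>
  have m_eq: "m q = artanh (J q (axis p2 1) $ x2 / J q (axis p2 1) $ p2)" if "q \<in> M" for q
    using J_p2[OF that] nf[OF that] artanh_tanh_real[of "m q"]
    by (simp add: tangent_vec_nth tanh_def)
  have m_cont: "continuous_on M m"
  proof -
    have ratio: "J q (axis p2 1) $ x2 / J q (axis p2 1) $ p2 \<in> {-1<..<1}" "J q (axis p2 1) $ p2 \<noteq> 0" if "q \<in> M" for q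
      using J_p2[OF that] nf[OF that] tanh_real_bounds[of "m q"]
      by (simp_all add: tangent_vec_nth tanh_def)
    have "continuous_on M (\<lambda>q. artanh (J q (axis p2 1) $ x2 / J q (axis p2 1) $ p2))"
      by (intro continuous_on_compose2[OF continuous_on_artanh[OF order_refl]] continuous_on_divide
          continuous_on_component cont ballI image_subsetI ratio)
    then show ?thesis by (simp add: m_eq cong: continuous_on_cong)
  qed
  have "\<forall>\<^sub>F q in nhds q0. q \<in> M \<and> \<bar>m q - m q0\<bar> < pi"
  proof -
    have "(m \<longlongrightarrow> m q0) (nhds q0)"
      using m_cont M by (simp add: continuous_on_eq_continuous_at isCont_def tendsto_at_iff_tendsto_nhds)
    then have "\<forall>\<^sub>F q in nhds q0. dist (m q) (m q0) < pi"
      by (rule tendstoD) simp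
    then show ?thesis
      using eventually_nhds_in_open[OF M] by eventually_elim (simp add: dist_real_def)
  qed
  then obtain e where e: "e > 0" "\<And>q. q \<in> ball q0 e \<Longrightarrow> q \<in> M \<and> \<bar>m q - m q0\<bar> < pi"
    unfolding eventually_nhds_metric by (metis dist_commute mem_ball)
  define D where "D = ball q0 e"
  have D: "open D" "convex D" "q0 \<in> D" and DM: "q \<in> D \<Longrightarrow> q \<in> M" and m_near: "q \<in> D \<Longrightarrow> \<bar>m q - m q0\<bar> < pi" for q
    using e by (auto simp: D_def)
  have J_lin: "J q (x *\<^sub>R w + y *\<^sub>R w') = x *\<^sub>R J q w + y *\<^sub>R J q w'" if "q \<in> D" for q x y w w'
  proof -
    have "linear (J q)"
      using diff[OF DM[OF that]] by (simp add: J_def linear_frechet_derivative)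
    then show ?thesis by (simp only: linear_add linear_scale)
  qed
  have shift: "J (q0 + d) w \<bullet> c = J q0 w \<bullet> c"
    if "q0 + d \<in> D" "\<And>q. q \<in> D \<Longrightarrow> J q d \<bullet> c = 0" for d w c
    unfolding J_def by (rule derivative_shift[OF D(1,2)]) (use that D(3) diff DM in \<open>auto simp: J_def\<close>)
  \<comment> \<open>Along the first factor the hyperbolic block of the derivative does not change.\<close>
  have m_osc: "m q = m q0" if q: "q = q0 + x *\<^sub>R axis x1 1 + y *\<^sub>R axis p1 1" "q \<in> D" for q x y
  proof (rule hyp_vec_direction_inj)
    have "J q (axis p2 1) \<bullet> axis k 1 = J q0 (axis p2 1) \<bullet> axis k 1" for k
    proof (cases "k = x2 \<or> k = p2")
      case True
      then show ?thesis
        unfolding q(1) add.assoc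
        by (intro shift) (use q in \<open>auto simp: add.assoc J_lin J_p1 J_x1 DM inner_axis tangent_vec_nth\<close>)
    next
      case False
      then show ?thesis
        using exhaust_4[of k] J_p2 DM q(2) D(3) by (auto simp: inner_axis tangent_vec_nth)
    qed
    then show "b q *\<^sub>R hyp_vec (m q) = b q0 *\<^sub>R hyp_vec (m q0)"
      using J_p2 DM q(2) D(3) by (simp add: vec_eq_iff inner_axis)
  qed (use nf DM q in auto)
  \<comment> \<open>Along the second factor the oscillator block does not change.\<close>
  have m_hyp: "m q = m q0" if q: "q = q0 + x *\<^sub>R axis x2 1 + y *\<^sub>R axis p2 1" "q \<in> D" for q x y
  proof (rule osc_vec_direction_inj)
    have "J q (axis p1 1) \<bullet> axis k 1 = J q0 (axis p1 1) \<bullet> axis k 1" for k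
    proof (cases "k = x1 \<or> k = p1")
      case True
      then show ?thesis
        unfolding q(1) add.assoc
        by (intro shift) (use q in \<open>auto simp: add.assoc J_lin J_p2 J_x2 DM inner_axis tangent_vec_nth\<close>)
    next
      case False
      then show ?thesis
        using exhaust_4[of k] J_p1 DM q(2) D(3) by (auto simp: inner_axis tangent_vec_nth)
    qed
    then show "r q *\<^sub>R osc_vec (m q) = r q0 *\<^sub>R osc_vec (m q0)"
      using J_p1 DM q(2) D(3) by (simp add: vec_eq_iff inner_axis)
  qed (use nf DM q m_near in auto)

  have s_sq: "s q * s q = 1" if "q \<in> M" for q
    using nf[OF that] by auto
  have contD: "continuous_on D (\<lambda>q. J q w \<bullet> c)" for w c
    by (intro continuous_intros continuous_on_subset[OF cont]) (use DM in auto)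
  have diffD: "\<phi> differentiable at q" if "q \<in> D" for q
    using that diff DM by blast
  have "\<partial> p1 (\<partial> p1 (\<partial> p1 u)) q0 = 0"
  proof (rule coefficient_second_derivative_zero[OF D(1,3) diffD, where c = "osc_vec (m q0)" and d = "osc_vec (m q0 + pi/2)" and i = x1])
    fix x y
    assume "q0 + x *\<^sub>R axis x1 1 + y *\<^sub>R axis p1 1 \<in> D"
    moreover define q where "q = q0 + x *\<^sub>R axis x1 1 + y *\<^sub>R axis p1 (1::real)"
    ultimately have q: "q \<in> D" "m q = m q0" "q \<in> M" using m_osc[of q x y] DM by auto
    show "let q = q0 + x *\<^sub>R axis x1 1 + y *\<^sub>R axis p1 1 in
       frechet_derivative \<phi> (at q) (axis p1 1) \<bullet> osc_vec (m q0) \<noteq> 0 \<and>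
       frechet_derivative \<phi> (at q) (axis x1 1) \<bullet> osc_vec (m q0) = - \<partial> p1 u q * (frechet_derivative \<phi> (at q) (axis p1 1) \<bullet> osc_vec (m q0)) \<and>
       frechet_derivative \<phi> (at q) (axis p1 1) \<bullet> osc_vec (m q0 + pi/2) = 0 \<and>
       (frechet_derivative \<phi> (at q) (axis x1 1) \<bullet> osc_vec (m q0 + pi/2))\<^sup>2 = (frechet_derivative \<phi> (at q) (axis p1 1) \<bullet> osc_vec (m q0))\<^sup>2"
      unfolding Let_def q_def[symmetric] J_def[symmetric]
      using nf[OF q(3)] s_sq[OF q(3)]
      by (auto simp: J_p1[OF q(3)] J_x1[OF q(3)] q(2) inner_diff_left tangent_vec_inner power_mult_distrib)
  qed (use contD in \<open>auto simp: J_def\<close>)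
  moreover have "\<partial> p2 (\<partial> p2 (\<partial> p2 v)) q0 = 0"
  proof (rule coefficient_second_derivative_zero[OF D(1,3) diffD, where c = "hyp_vec (- m q0)" and d = "hyp_deriv_vec (- m q0)" and i = x2])
    fix x y
    assume "q0 + x *\<^sub>R axis x2 1 + y *\<^sub>R axis p2 1 \<in> D"
    moreover define q where "q = q0 + x *\<^sub>R axis x2 1 + y *\<^sub>R axis p2 (1::real)"
    ultimately have q: "q \<in> D" "m q = m q0" "q \<in> M" using m_hyp[of q x y] DM by auto
    show "let q = q0 + x *\<^sub>R axis x2 1 + y *\<^sub>R axis p2 1 in
       frechet_derivative \<phi> (at q) (axis p2 1) \<bullet> hyp_vec (- m q0) \<noteq> 0 \<and>
       frechet_derivative \<phi> (at q) (axis x2 1) \<bullet> hyp_vec (- m q0) = - \<partial> p2 v q * (frechet_derivative \<phi> (at q) (axis p2 1) \<bullet> hyp_vec (- m q0)) \<and>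
       frechet_derivative \<phi> (at q) (axis p2 1) \<bullet> hyp_deriv_vec (- m q0) = 0 \<and>
       (frechet_derivative \<phi> (at q) (axis x2 1) \<bullet> hyp_deriv_vec (- m q0))\<^sup>2 = (frechet_derivative \<phi> (at q) (axis p2 1) \<bullet> hyp_vec (- m q0))\<^sup>2"
      unfolding Let_def q_def[symmetric] J_def[symmetric]
      using nf[OF q(3)] s_sq[OF q(3)]
      by (auto simp: J_p2[OF q(3)] J_x2[OF q(3)] q(2) inner_diff_left tangent_vec_inner power_mult_distrib)
  qed (use contD in \<open>auto simp: J_def\<close>)
  ultimately show ?thesis ..
qed

section \<open>The corollary\<close>

theorem corollary2:
  fixes f g :: "real \<times> real \<Rightarrow> real"
    and U V :: "(real \<times> real) set"
    and u v :: "real^4 \<Rightarrow> real"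
    and M :: "(real^4) set"
  assumes "open U" and "open V"
    and "smooth_on U f" and "smooth_on V g"
    and "M = {q. (q $ x1, q $ p1) \<in> U \<and> (q $ x2, q $ p2) \<in> V}"
    and "u = (\<lambda>q. f (q $ x1, q $ p1))"
    and "v = (\<lambda>q. g (q $ x2, q $ p2))"
  shows "solves_system M u v \<and>
    ((\<exists>q\<in>M. \<partial> p1 (\<partial> p1 (\<partial> p1 u)) q \<noteq> 0) \<or> (\<exists>q\<in>M. \<partial> p2 (\<partial> p2 (\<partial> p2 v)) q \<noteq> 0) \<longrightarrow>
     (\<forall>N. open N \<longrightarrow>
       \<not> cone_structures_diffeomorphic M (cone_structure u v)
           N (cone_structure (\<lambda>q. 0) (\<lambda>q. 0))))"
proof (intro conjI impI allI notI)
  show "solves_system M u v"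
    using assms(6,7) by (rule separated_solves)
next
  fix N
  assume nz: "(\<exists>q\<in>M. \<partial> p1 (\<partial> p1 (\<partial> p1 u)) q \<noteq> 0) \<or> (\<exists>q\<in>M. \<partial> p2 (\<partial> p2 (\<partial> p2 v)) q \<noteq> 0)"
    and "cone_structures_diffeomorphic M (cone_structure u v) N (cone_structure (\<lambda>q. 0) (\<lambda>q. 0))"
  then obtain \<phi> where \<phi>: "smooth_on M \<phi>" and cones:
    "\<And>q. q \<in> M \<Longrightarrow> frechet_derivative \<phi> (at q) ` cone_structure u v q = cone_structure (\<lambda>_. 0) (\<lambda>_. 0) (\<phi> q)"
    by (auto simp: cone_structures_diffeomorphic_def diffeomorphism_on_def)
  have "M = (\<lambda>q. (q $ x1, q $ p1)) -` U \<inter> (\<lambda>q. (q $ x2, q $ p2)) -` V"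
    using assms(5) by auto
  then have M: "open M"
    using assms(1,2) by (auto intro!: open_Int open_vimage continuous_on_Pair continuous_on_component)
  have "\<partial> p2 u q = 0" "\<partial> p1 v q = 0" for q
    unfolding assms(6,7) by (rule partial_deriv_cong_zero; simp add: axis_def)+
  then show False
    using nz third_derivatives_vanish_if_flat[OF M _ \<phi> cones] by blast
qed

end
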